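(* Consider the adversarial-order secretary problem with an $\alpha$-power signal (defined in the context), where $\alpha=\alpha(n)>0$ may depend on $n$, and let $n\to\infty$. If $\alpha=o(n)$, then $\mathrm{OPT}^{\mathrm{rand}}_n(\alpha)=o(1)$. If $\alpha/n\to c\in(0,\infty)$, then $\mathrm{OPT}^{\mathrm{rand}}_n(\alpha)\to 1-e^{-c}$.
   Context: Notation: $[n]=\{1,\dots,n\}$. Adversarial-order secretary problem with an $\alpha$-power signal ($\alpha>0$ real): an adversary fixes an instance, i.e. a value vector $v\in\mathbb{N}_0^n$ with a unique maximum entry, located at a time $i^\star\in[n]$. Items arrive one by one at times $1,\dots,n$ in this order. A signal time $S\in[i^\star]$ is drawn with $$\Pr[S=s]=\frac{s^\alpha-(s-1)^\alpha}{(i^\star)^\alpha},\qquad s\in[i^\star].$$ At each time $t$ the policy observes $v_t$ and whether the content-free signal occurs at time $t$ ($S=t$); it then irrevocably decides whether to stop at time $t$. The policy knows $n$ and $\alpha$, but not the instance. It succeeds if it stops exactly at time $i^\star$. A randomized policy may use internal randomness independent of the signal. The worst-case success probability of a policy is the infimum over all instances of length $n$ of its success probability (over the signal and the internal randomness); $\mathrm{OPT}^{\mathrm{rand}}_n(\alpha)$ is the supremum of the worst-case success probability over all randomized policies. *)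

theory Defs
  imports "HOL-Probability.Probability" "HOL-Library.Landau_Symbols"
begin

definition unique_max_at :: "nat \<Rightarrow> (nat \<Rightarrow> nat) \<Rightarrow> nat \<Rightarrow> bool" where
  "unique_max_at n v i \<longleftrightarrow> i \<in> {1..n} \<and> (\<forall>j\<in>{1..n}. j \<noteq> i \<longrightarrow> v j < v i)"

definition instances :: "nat \<Rightarrow> (nat \<Rightarrow> nat) set" where
  "instances n = {v \<in> {1..n} \<rightarrow>\<^sub>E UNIV. \<exists>i. unique_max_at n v i}"

definition max_time :: "nat \<Rightarrow> (nat \<Rightarrow> nat) \<Rightarrow> nat" where
  "max_time n v = (THE i. unique_max_at n v i)"

lemma max_time_eq:
  assumes "unique_max_at n v i"
  shows "max_time n v = i"
  unfolding max_time_def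
proof (rule the_equality)
  show "unique_max_at n v i" by (fact assms)
  show "j = i" if "unique_max_at n v j" for j
    using assms that unfolding unique_max_at_def by (metis less_asym)
qed

definition signal_mass :: "real \<Rightarrow> nat \<Rightarrow> nat \<Rightarrow> real" where
  "signal_mass \<alpha> i s =
     (if s \<in> {1..i} then (real s powr \<alpha> - (real s - 1) powr \<alpha>) / real i powr \<alpha> else 0)"

definition signal_pmf :: "real \<Rightarrow> nat \<Rightarrow> nat pmf" where
  "signal_pmf \<alpha> i = embed_pmf (signal_mass \<alpha> i)"

lemma signal_mass_nonneg:
  assumes "\<alpha> > 0"
  shows "signal_mass \<alpha> i s \<ge> 0"
  using assms by (auto simp: signal_mass_def intro!: divide_nonneg_nonneg powr_mono2)

lemma sum_signal_mass:
  assumes "i \<ge> 1"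
  shows "(\<Sum>s=1..i. signal_mass \<alpha> i s) = 1"
proof -
  have tel: "(\<Sum>s=1..k. real s powr \<alpha> - (real s - 1) powr \<alpha>) = real k powr \<alpha>" for k
    by (induction k) auto
  have "(\<Sum>s=1..i. signal_mass \<alpha> i s)
      = (\<Sum>s=1..i. real s powr \<alpha> - (real s - 1) powr \<alpha>) / real i powr \<alpha>"
    by (simp add: signal_mass_def sum_divide_distrib)
  also have "\<dots> = 1"
    unfolding tel using assms by simp
  finally show ?thesis .
qed

lemma pmf_signal:
  assumes "\<alpha> > 0" "i \<ge> 1"
  shows "pmf (signal_pmf \<alpha> i) s = signal_mass \<alpha> i s"
  unfolding signal_pmf_def
proof (rule pmf_embed_pmf)
  show "0 \<le> signal_mass \<alpha> i x" for x
    using assms(1) by (rule signal_mass_nonneg)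
  have "(\<integral>\<^sup>+ x. ennreal (signal_mass \<alpha> i x) \<partial>count_space UNIV)
      = (\<Sum>x\<in>{1..i}. ennreal (signal_mass \<alpha> i x))"
    by (rule nn_integral_count_space') (auto simp: signal_mass_def)
  also have "\<dots> = ennreal (\<Sum>x=1..i. signal_mass \<alpha> i x)"
    using assms(1) by (intro sum_ennreal signal_mass_nonneg)
  finally show "(\<integral>\<^sup>+ x. ennreal (signal_mass \<alpha> i x) \<partial>count_space UNIV) = 1"
    unfolding sum_signal_mass[OF assms(2)] by simp
qed

text \<open>What has been observed by time \<open>t\<close>: for every \<open>j \<le> t\<close>, in order, the value \<open>v j\<close> and
  whether the signal (occurring at time \<open>s\<close>) occurred at time \<open>j\<close>.\<close>

definition history :: "(nat \<Rightarrow> nat) \<Rightarrow> nat \<Rightarrow> nat \<Rightarrow> (nat \<times> bool) list" where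
  "history v s t = map (\<lambda>j. (v j, s = j)) [1..<Suc t]"

type_synonym policy = "(nat \<times> bool) list \<Rightarrow> bool"

definition stops_at :: "policy \<Rightarrow> (nat \<Rightarrow> nat) \<Rightarrow> nat \<Rightarrow> nat \<Rightarrow> bool" where
  "stops_at p v s t \<longleftrightarrow> p (history v s t) \<and> (\<forall>t'\<in>{1..<t}. \<not> p (history v s t'))"

text \<open>A randomized policy consists of the distribution of an internal random seed and a
  deterministic policy for each seed. Taking the seed to be a real number is no restriction: a
  randomized policy is determined by the joint law of its decisions on the countably many
  possible histories, and every law on a countable product of two-point spaces is the law of a
  measurable function of a real seed.\<close>

definition randomized_policies :: "(real measure \<times> (real \<Rightarrow> policy)) set" where
  "randomized_policies =
     {(M, \<pi>). prob_space M \<and> (\<forall>h. Measurable.pred M (\<lambda>r. \<pi> r h))}"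

text \<open>The product measure expresses that the seed is independent of the signal.\<close>

definition success_prob ::
  "nat \<Rightarrow> real \<Rightarrow> real measure \<times> (real \<Rightarrow> policy) \<Rightarrow> (nat \<Rightarrow> nat) \<Rightarrow> real" where
  "success_prob n \<alpha> = (\<lambda>(M, \<pi>) v.
     \<P>((r, s) in M \<Otimes>\<^sub>M measure_pmf (signal_pmf \<alpha> (max_time n v)). stops_at (\<pi> r) v s (max_time n v)))"

lemma success_event_measurable:
  assumes "(M, \<pi>) \<in> randomized_policies"
  shows "Measurable.pred (M \<Otimes>\<^sub>M measure_pmf P) (\<lambda>(r, s). stops_at (\<pi> r) v s t)"
proof -
  have [measurable]: "Measurable.pred M (\<lambda>r. \<pi> r h)" for h
    using assms by (auto simp: randomized_policies_def)
  have "Measurable.pred (M \<Otimes>\<^sub>M count_space UNIV) (\<lambda>(r, s). stops_at (\<pi> r) v s t)"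
    unfolding split_beta
  proof (rule measurable_compose_countable[where g = snd])
    show "Measurable.pred (M \<Otimes>\<^sub>M count_space UNIV) (\<lambda>x. stops_at (\<pi> (fst x)) v s t)" for s :: nat
      unfolding stops_at_def by measurable
  qed measurable
  then show ?thesis
    by (subst measurable_cong_sets[OF sets_pair_measure_cong refl]) auto
qed

definition worst_case_success ::
  "nat \<Rightarrow> real \<Rightarrow> real measure \<times> (real \<Rightarrow> policy) \<Rightarrow> real" where
  "worst_case_success n \<alpha> R = (INF v\<in>instances n. success_prob n \<alpha> R v)"

definition OPT_rand :: "nat \<Rightarrow> real \<Rightarrow> real" where
  "OPT_rand n \<alpha> = (SUP R\<in>randomized_policies. worst_case_success n \<alpha> R)"

end

theory Submission
  imports Defs "HOL-Real_Asymp.Real_Asymp"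
begin

text \<open>Lower bound: stopping at the signal succeeds iff \<open>S = i\<^sup>\<star>\<close>, which has probability at least
  \<open>1 - (1 - 1/n)\<^sup>\<alpha>\<close>. Upper bound: consider the \<open>n\<close> instances \<open>(1, 2, \<dots>, m, 0, \<dots>, 0)\<close>, which are
  indistinguishable before their maxima. If \<open>q s m\<close> is the probability of stopping at \<open>m\<close> when the
  signal occurs at \<open>s\<close>, then \<open>m\<^sup>\<alpha>\<close> times the success probability on the \<open>m\<close>-th instance is
  \<open>\<Sum>s\<le>m. (s\<^sup>\<alpha> - (s - 1)\<^sup>\<alpha>) * q s m\<close>. As \<open>\<Sum>m. q s m \<le> 1\<close>, summing over \<open>m\<close> bounds the worst case
  by \<open>n\<^sup>\<alpha> / (\<Sum>m\<le>n. m\<^sup>\<alpha>)\<close>. If \<open>\<alpha>/n \<rightarrow> c\<close>, both bounds tend to \<open>1 - e\<^sup>-\<^sup>c\<close>, also for \<open>c = 0\<close>.\<close>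

section \<open>Success probability as a finite sum over signal times\<close>

text \<open>Fubini: the seed is independent of the signal, so it is integrated out first for each
  fixed signal time \<open>s\<close>. The remaining integral is a finite sum because the signal law
  lives on \<open>{1..i}\<close>.\<close>

lemma success_prob_eq_sum:
  assumes R: "(M, \<pi>) \<in> randomized_policies" and v: "unique_max_at n v i" and \<alpha>: "\<alpha> > 0"
  shows "success_prob n \<alpha> (M, \<pi>) v =
    (\<Sum>s=1..i. signal_mass \<alpha> i s * measure M {r \<in> space M. stops_at (\<pi> r) v s i})"
proof -
  interpret M: prob_space M
    using R by (simp add: randomized_policies_def)
  let ?P = "signal_pmf \<alpha> i"
  interpret P: pair_prob_space M "measure_pmf ?P" ..
  let ?A = "{(r, s). (r, s) \<in> space (M \<Otimes>\<^sub>M measure_pmf ?P) \<and> stops_at (\<pi> r) v s i}"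
  have i: "i \<ge> 1"
    using v by (simp add: unique_max_at_def)
  have A: "?A \<in> sets (M \<Otimes>\<^sub>M measure_pmf ?P)"
    using success_event_measurable[OF R, where P = ?P and v = v and t = i]
    by (auto simp: pred_def elim!: back_subst[of "\<lambda>A. A \<in> _"])
  have "emeasure (M \<Otimes>\<^sub>M measure_pmf ?P) ?A =
      (\<integral>\<^sup>+ s. emeasure M ((\<lambda>r. (r, s)) -` ?A) \<partial>measure_pmf ?P)"
    by (rule P.emeasure_pair_measure_alt2[OF A])
  also have "\<dots> = (\<integral>\<^sup>+ s. ennreal (measure M {r \<in> space M. stops_at (\<pi> r) v s i}) \<partial>measure_pmf ?P)"
    by (intro nn_integral_cong)
      (auto simp: M.emeasure_eq_measure space_pair_measure intro!: arg_cong[where f = "measure M"])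
  also have "\<dots> = ennreal (\<integral>s. measure M {r \<in> space M. stops_at (\<pi> r) v s i} \<partial>measure_pmf ?P)"
    by (intro nn_integral_eq_integral measure_pmf.integrable_const_bound[where B = 1]) auto
  also have "(\<integral>s. measure M {r \<in> space M. stops_at (\<pi> r) v s i} \<partial>measure_pmf ?P) =
      (\<Sum>s=1..i. measure M {r \<in> space M. stops_at (\<pi> r) v s i} * pmf ?P s)"
    by (rule integral_measure_pmf_real)
      (auto simp: set_pmf_iff pmf_signal[OF \<alpha> i] signal_mass_def split: if_splits)
  finally have "measure (M \<Otimes>\<^sub>M measure_pmf ?P) ?A =
      (\<Sum>s=1..i. measure M {r \<in> space M. stops_at (\<pi> r) v s i} * pmf ?P s)"
    by (simp add: measure_def sum_nonneg)
  then show ?thesis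
    by (simp add: success_prob_def max_time_eq[OF v] pmf_signal[OF \<alpha> i] mult.commute)
qed

lemma success_prob_nonneg: "success_prob n \<alpha> R v \<ge> 0"
  by (cases R) (simp add: success_prob_def)

lemma success_prob_le_1:
  assumes "R \<in> randomized_policies"
  shows "success_prob n \<alpha> R v \<le> 1"
proof -
  obtain M \<pi> where R: "R = (M, \<pi>)"
    by (cases R)
  interpret M: prob_space M
    using assms by (simp add: R randomized_policies_def)
  interpret P: pair_prob_space M "measure_pmf (signal_pmf \<alpha> (max_time n v))" ..
  show ?thesis
    by (simp add: R success_prob_def)
qed

lemma bdd_below_success_prob: "bdd_below (success_prob n \<alpha> R ` A)"
  by (rule bdd_belowI[of _ 0]) (auto simp: success_prob_nonneg)

lemma worst_case_success_le:
  assumes "v \<in> instances n"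
  shows "worst_case_success n \<alpha> R \<le> success_prob n \<alpha> R v"
  unfolding worst_case_success_def using assms by (intro cINF_lower bdd_below_success_prob)

section \<open>Upper bound from indistinguishable instances\<close>

text \<open>The restricted lambda matches \<open>instances\<close>, whose members are extensional on
  \<open>{1..n}\<close>.\<close>

definition ramp :: "nat \<Rightarrow> nat \<Rightarrow> nat \<Rightarrow> nat" where
  "ramp n m = (\<lambda>j\<in>{1..n}. if j \<le> m then j else 0)"

lemma unique_max_at_ramp:
  assumes "m \<in> {1..n}"
  shows "unique_max_at n (ramp n m) m"
  using assms by (auto simp: unique_max_at_def ramp_def)

lemma ramp_in_instances:
  assumes "m \<in> {1..n}"
  shows "ramp n m \<in> instances n"
  using unique_max_at_ramp[OF assms] by (auto simp: instances_def ramp_def)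

text \<open>Whether a policy stops at \<open>m\<close> depends only on what it sees up to time
  \<open>m\<close>, and there the ramp shows the values 1, ..., \<open>m\<close>. Thus
  \<open>id\<close> serves as one common value sequence for all \<open>m\<close>.\<close>

lemma stops_at_ramp:
  assumes "m \<in> {1..n}"
  shows "stops_at p (ramp n m) s m \<longleftrightarrow> stops_at p id s m"
proof -
  have "history (ramp n m) s t = history id s t" if "t \<le> m" for t
    using assms that by (auto simp: history_def ramp_def)
  then show ?thesis
    by (simp add: stops_at_def)
qed

lemma stops_at_unique:
  assumes "stops_at p v s t" "stops_at p v s t'" "t \<ge> 1" "t' \<ge> 1"
  shows "t = t'"
  using assms unfolding stops_at_def by (metis atLeastLessThan_iff linorder_neqE_nat)

text \<open>With values and signal time fixed, the events of stopping at different times are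
  disjoint.\<close>

lemma sum_prob_stops_at_le_1:
  assumes R: "(M, \<pi>) \<in> randomized_policies"
  shows "(\<Sum>m=1..n. measure M {r \<in> space M. stops_at (\<pi> r) v s m}) \<le> 1"
proof -
  interpret M: prob_space M
    using R by (simp add: randomized_policies_def)
  have [measurable]: "Measurable.pred M (\<lambda>r. \<pi> r h)" for h
    using R by (auto simp: randomized_policies_def)
  have "{r \<in> space M. stops_at (\<pi> r) v s m} \<in> sets M" for m
    unfolding stops_at_def by measurable
  moreover have "disjoint_family_on (\<lambda>m. {r \<in> space M. stops_at (\<pi> r) v s m}) {1..n}"
    using stops_at_unique by (fastforce simp: disjoint_family_on_def)
  ultimately have "(\<Sum>m=1..n. measure M {r \<in> space M. stops_at (\<pi> r) v s m}) =
      measure M (\<Union>m\<in>{1..n}. {r \<in> space M. stops_at (\<pi> r) v s m})"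
    by (intro M.finite_measure_finite_Union[symmetric]) auto
  then show ?thesis
    by simp
qed

lemma worst_case_success_upper:
  assumes R: "R \<in> randomized_policies" and n: "n \<ge> 1" and \<alpha>: "\<alpha> > 0"
  shows "worst_case_success n \<alpha> R \<le> real n powr \<alpha> / (\<Sum>m=1..n. real m powr \<alpha>)"
proof -
  obtain M \<pi> where R_eq: "R = (M, \<pi>)"
    by (cases R)
  define q where "q s m = measure M {r \<in> space M. stops_at (\<pi> r) id s m}" for s m
  define w where "w s = real s powr \<alpha> - (real s - 1) powr \<alpha>" for s
  have w_nonneg: "w s \<ge> 0" if "s \<ge> 1" for s
    using that \<alpha> by (auto simp: w_def intro!: powr_mono2)
  have "worst_case_success n \<alpha> R * real m powr \<alpha> \<le> (\<Sum>s=1..n. w s * q s m)" if m: "m \<in> {1..n}" for m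
  proof -
    have "worst_case_success n \<alpha> R \<le> success_prob n \<alpha> (M, \<pi>) (ramp n m)"
      using worst_case_success_le[OF ramp_in_instances[OF m]] by (simp add: R_eq)
    also have "\<dots> = (\<Sum>s=1..m. signal_mass \<alpha> m s * q s m)"
      using R unfolding R_eq
      by (subst success_prob_eq_sum[OF _ unique_max_at_ramp[OF m] \<alpha>])
        (auto simp: stops_at_ramp[OF m] q_def)
    also have "\<dots> = (\<Sum>s=1..m. w s * q s m) / real m powr \<alpha>"
      by (simp add: signal_mass_def w_def sum_divide_distrib)
    \<comment> \<open>Multiplying by \<open>real m powr \<alpha>\<close> cancels the normalisation
      of the signal law, leaving weights \<open>w s\<close> that do not depend on
      \<open>m\<close>.\<close>
    finally have "worst_case_success n \<alpha> R * real m powr \<alpha> \<le> (\<Sum>s=1..m. w s * q s m)"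
      using m by (simp add: field_simps)
    \<comment> \<open>Adding nonnegative terms makes the range of \<open>s\<close> independent of
      \<open>m\<close>, which allows the sums to be swapped below.\<close>
    also have "\<dots> \<le> (\<Sum>s=1..n. w s * q s m)"
      using m by (intro sum_mono2) (auto intro!: mult_nonneg_nonneg w_nonneg simp: q_def)
    finally show ?thesis .
  qed
  then have "worst_case_success n \<alpha> R * (\<Sum>m=1..n. real m powr \<alpha>) \<le> (\<Sum>m=1..n. \<Sum>s=1..n. w s * q s m)"
    unfolding sum_distrib_left by (rule sum_mono)
  also have "\<dots> = (\<Sum>s=1..n. w s * (\<Sum>m=1..n. q s m))"
    by (subst sum.swap) (simp add: sum_distrib_left)
  also have "\<dots> \<le> (\<Sum>s=1..n. w s * 1)"
    using R unfolding R_eq q_def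
    by (intro sum_mono mult_left_mono sum_prob_stops_at_le_1 w_nonneg) auto
  \<comment> \<open>The sum telescopes; its lower end is \<open>0 powr \<alpha> = 0\<close>.\<close>
  also have "\<dots> = real n powr \<alpha>"
    unfolding w_def by (induction n) auto
  finally have "worst_case_success n \<alpha> R * (\<Sum>m=1..n. real m powr \<alpha>) \<le> real n powr \<alpha>" .
  moreover have "(\<Sum>m=1..n. real m powr \<alpha>) > 0"
    using n by (intro sum_pos) auto
  ultimately show ?thesis
    by (simp add: pos_le_divide_eq)
qed

section \<open>Lower bound from stopping at the signal\<close>

text \<open>A deterministic policy: the seed is a point mass and is ignored. The flag of the last
  history entry tells whether the signal occurs now.\<close>

definition stop_at_signal :: "real measure \<times> (real \<Rightarrow> policy)" where
  "stop_at_signal = (return borel 0, \<lambda>_ h. h \<noteq> [] \<and> snd (last h))"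

lemma stop_at_signal_policy: "stop_at_signal \<in> randomized_policies"
  by (simp add: stop_at_signal_def randomized_policies_def prob_space_return)

lemma worst_case_success_stop_at_signal:
  assumes n: "n \<ge> 1" and \<alpha>: "\<alpha> > 0"
  shows "worst_case_success n \<alpha> stop_at_signal \<ge> 1 - (1 - 1 / real n) powr \<alpha>"
  unfolding worst_case_success_def
proof (rule cINF_greatest)
  show "instances n \<noteq> {}"
    using ramp_in_instances[of 1 n] n by auto
next
  fix v assume "v \<in> instances n"
  then obtain i where v: "unique_max_at n v i"
    by (auto simp: instances_def)
  then have i: "1 \<le> i" "i \<le> n"
    by (auto simp: unique_max_at_def)
  have stops: "stops_at (\<lambda>h. h \<noteq> [] \<and> snd (last h)) v s i \<longleftrightarrow> s = i" for s
    using i by (auto simp: stops_at_def history_def)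
  \<comment> \<open>The set of successful seeds does not depend on the seed: it is everything or
    empty.\<close>
  have prob: "measure (return borel (0::real)) (if s = i then UNIV else {}) =
      (if s = i then 1 else 0)" for s
    using prob_space.prob_space[OF prob_space_return[of "0::real" borel]] by simp
  \<comment> \<open>The success probability decreases in the position \<open>i\<close> of the
    maximum, so \<open>i = n\<close> is the worst position.\<close>
  have "1 - (1 - 1 / real n) powr \<alpha> \<le> 1 - (1 - 1 / real i) powr \<alpha>"
    using i \<alpha> by (auto intro!: powr_mono2 simp: field_simps)
  also have "\<dots> = signal_mass \<alpha> i i"
    using i \<alpha> by (simp add: signal_mass_def diff_divide_distrib flip: powr_divide)
  also have "\<dots> = (\<Sum>s=1..i. signal_mass \<alpha> i s * (if s = i then 1 else 0))"
    using i by (simp add: if_distrib cong: if_cong)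
  also have "\<dots> = success_prob n \<alpha> stop_at_signal v"
    unfolding stop_at_signal_def
    by (subst success_prob_eq_sum[OF _ v \<alpha>])
      (use stop_at_signal_policy in \<open>simp_all add: stop_at_signal_def stops prob\<close>)
  finally show "1 - (1 - 1 / real n) powr \<alpha> \<le> success_prob n \<alpha> stop_at_signal v" .
qed

section \<open>Bounds on the optimum\<close>

lemma OPT_rand_lower:
  assumes n: "n \<ge> 1" and \<alpha>: "\<alpha> > 0"
  shows "1 - (1 - 1 / real n) powr \<alpha> \<le> OPT_rand n \<alpha>"
proof -
  \<comment> \<open>A real supremum dominates its members only if the set is bounded above; a single
    instance already bounds each infimum by 1.\<close>
  have "worst_case_success n \<alpha> R \<le> 1" if "R \<in> randomized_policies" for R
    using worst_case_success_le[OF ramp_in_instances, of 1 n \<alpha> R] success_prob_le_1[OF that] n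
    by (meson atLeastAtMost_iff order.refl order.trans)
  then have "bdd_above (worst_case_success n \<alpha> ` randomized_policies)"
    by (auto intro!: bdd_aboveI)
  then have "worst_case_success n \<alpha> stop_at_signal \<le> OPT_rand n \<alpha>"
    unfolding OPT_rand_def by (intro cSUP_upper stop_at_signal_policy)
  with worst_case_success_stop_at_signal[OF assms] show ?thesis
    by simp
qed

text \<open>Only the \<open>K\<close> largest terms \<open>m = n - k\<close> of the power sum are
  kept. With \<open>K\<close> fixed, the limit in \<open>n\<close> can later be taken term by
  term.\<close>

lemma OPT_rand_upper:
  assumes n: "n \<ge> 1" and \<alpha>: "\<alpha> > 0" and K: "1 \<le> K" "K \<le> n"
  shows "OPT_rand n \<alpha> \<le> 1 / (\<Sum>k<K. (1 - real k / real n) powr \<alpha>)"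
proof -
  have "(\<Sum>k<K. (1 - real k / real n) powr \<alpha>) = (\<Sum>k<K. real (n - k) powr \<alpha>) / real n powr \<alpha>"
    unfolding sum_divide_distrib using K
    by (intro sum.cong refl) (simp add: of_nat_diff diff_divide_distrib flip: powr_divide)
  also have "(\<Sum>k<K. real (n - k) powr \<alpha>) = (\<Sum>m\<in>(\<lambda>k. n - k) ` {..<K}. real m powr \<alpha>)"
    using K by (subst sum.reindex) (auto simp: inj_on_def)
  also have "\<dots> \<le> (\<Sum>m=1..n. real m powr \<alpha>)"
    using K by (intro sum_mono2) auto
  finally have le: "(\<Sum>k<K. (1 - real k / real n) powr \<alpha>) \<le> (\<Sum>m=1..n. real m powr \<alpha>) / real n powr \<alpha>"
    by (simp add: divide_right_mono)
  have pos: "(\<Sum>k<K. (1 - real k / real n) powr \<alpha>) > 0"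
    using K by (intro sum_pos) (auto simp: lessThan_empty_iff)
  have "OPT_rand n \<alpha> \<le> real n powr \<alpha> / (\<Sum>m=1..n. real m powr \<alpha>)"
    unfolding OPT_rand_def using stop_at_signal_policy
    by (intro cSUP_least worst_case_success_upper n \<alpha>) auto
  also have "\<dots> = 1 / ((\<Sum>m=1..n. real m powr \<alpha>) / real n powr \<alpha>)"
    by simp
  also have "\<dots> \<le> 1 / (\<Sum>k<K. (1 - real k / real n) powr \<alpha>)"
    using le pos by (intro divide_left_mono mult_pos_pos) auto
  finally show ?thesis .
qed

section \<open>Limits\<close>

text \<open>The power is the exponential of \<open>\<alpha> n / n\<close> times
  \<open>n * ln (1 - k / n)\<close>, whose factors tend to \<open>c\<close> and \<open>- k\<close>.
  Taking \<open>n > k\<close> keeps the base positive.\<close>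

lemma tendsto_powr_exp:
  fixes \<alpha> :: "nat \<Rightarrow> real"
  assumes "(\<lambda>n. \<alpha> n / real n) \<longlonglongrightarrow> c"
  shows "(\<lambda>n. (1 - real k / real n) powr \<alpha> n) \<longlonglongrightarrow> exp (- c) ^ k"
proof -
  have "(\<lambda>n. real n * ln (1 - real k / real n)) \<longlonglongrightarrow> - real k"
    by real_asymp
  then have "(\<lambda>n. exp (\<alpha> n / real n * (real n * ln (1 - real k / real n)))) \<longlonglongrightarrow> exp (c * - real k)"
    using assms by (intro tendsto_intros)
  moreover have "\<forall>\<^sub>F n in sequentially.
      exp (\<alpha> n / real n * (real n * ln (1 - real k / real n))) = (1 - real k / real n) powr \<alpha> n"
    using eventually_gt_at_top[of k] by eventually_elim (auto simp: powr_def)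
  ultimately show ?thesis
    by (simp add: tendsto_cong mult.commute flip: exp_of_nat_mult)
qed

text \<open>For \<open>c = 0\<close> the sum is \<open>K\<close> and the quotient
  \<open>1 / K\<close> vanishes; otherwise the geometric series converges.\<close>

lemma tendsto_inverse_geometric_sum:
  assumes "c \<ge> (0::real)"
  shows "(\<lambda>K. 1 / (\<Sum>k<K. exp (- c) ^ k)) \<longlonglongrightarrow> 1 - exp (- c)"
proof (cases "c = 0")
  case True
  then show ?thesis
    by (simp add: lim_1_over_n)
next
  case False
  with assms have "(\<lambda>k. exp (- c) ^ k) sums (1 / (1 - exp (- c)))"
    by (intro geometric_sums) auto
  then have "(\<lambda>K. 1 / (\<Sum>k<K. exp (- c) ^ k)) \<longlonglongrightarrow> 1 / (1 / (1 - exp (- c)))"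
    using False unfolding sums_def by (intro tendsto_intros) auto
  then show ?thesis
    by simp
qed

lemma tendsto_OPT_rand:
  fixes \<alpha> :: "nat \<Rightarrow> real"
  assumes \<alpha>: "\<And>n. n \<ge> 1 \<Longrightarrow> \<alpha> n > 0" and lim: "(\<lambda>n. \<alpha> n / real n) \<longlonglongrightarrow> c" and c: "c \<ge> 0"
  shows "(\<lambda>n. OPT_rand n (\<alpha> n)) \<longlonglongrightarrow> 1 - exp (- c)"
proof (rule order_tendstoI)
  fix a assume "a < 1 - exp (- c)"
  moreover have "(\<lambda>n. 1 - (1 - 1 / real n) powr \<alpha> n) \<longlonglongrightarrow> 1 - exp (- c)"
    using tendsto_diff[OF tendsto_const tendsto_powr_exp[OF lim, of 1], of 1] by simp
  ultimately have "\<forall>\<^sub>F n in sequentially. a < 1 - (1 - 1 / real n) powr \<alpha> n"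
    by (metis order_tendstoD(1))
  then show "\<forall>\<^sub>F n in sequentially. a < OPT_rand n (\<alpha> n)"
    using eventually_ge_at_top[of 1]
  proof eventually_elim
    case (elim n)
    with OPT_rand_lower[of n "\<alpha> n"] \<alpha>[of n] show ?case
      by simp
  qed
next
  fix a assume "1 - exp (- c) < a"
  then have "\<forall>\<^sub>F K in sequentially. 1 / (\<Sum>k<K. exp (- c) ^ k) < a"
    by (rule order_tendstoD(2)[OF tendsto_inverse_geometric_sum[OF c]])
  then have "\<forall>\<^sub>F K in sequentially. 1 / (\<Sum>k<K. exp (- c) ^ k) < a \<and> K \<ge> 1"
    using eventually_ge_at_top[of 1] by eventually_elim simp
  \<comment> \<open>\<open>K\<close> is chosen from \<open>a\<close> alone, before \<open>n\<close>
    grows, so no uniformity in \<open>K\<close> is required.\<close>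
  then obtain K where K: "1 / (\<Sum>k<K. exp (- c) ^ k) < a" "K \<ge> 1"
    using eventually_happens trivial_limit_sequentially by blast
  have "(\<Sum>k<K. exp (- c) ^ k) > 0"
    using K(2) by (intro sum_pos) (auto simp: lessThan_empty_iff)
  then have "(\<lambda>n. 1 / (\<Sum>k<K. (1 - real k / real n) powr \<alpha> n)) \<longlonglongrightarrow> 1 / (\<Sum>k<K. exp (- c) ^ k)"
    by (intro tendsto_intros tendsto_powr_exp lim) auto
  then have "\<forall>\<^sub>F n in sequentially. 1 / (\<Sum>k<K. (1 - real k / real n) powr \<alpha> n) < a"
    using K(1) by (rule order_tendstoD(2))
  then show "\<forall>\<^sub>F n in sequentially. OPT_rand n (\<alpha> n) < a"
    using eventually_ge_at_top[of K]
  proof eventually_elim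
    case (elim n)
    with OPT_rand_upper[of n "\<alpha> n" K] \<alpha>[of n] K(2) show ?case
      by simp
  qed
qed

theorem corollary5:
  fixes \<alpha> :: "nat \<Rightarrow> real"
  assumes "\<And>n. n \<ge> 1 \<Longrightarrow> \<alpha> n > 0"
  shows "(\<alpha> \<in> o(\<lambda>n. real n) \<longrightarrow> (\<lambda>n. OPT_rand n (\<alpha> n)) \<in> o(\<lambda>_. 1)) \<and>
    (\<forall>c>0. (\<lambda>n. \<alpha> n / real n) \<longlonglongrightarrow> c \<longrightarrow>
      (\<lambda>n. OPT_rand n (\<alpha> n)) \<longlonglongrightarrow> 1 - exp (- c))"
proof (intro conjI allI impI)
  assume "\<alpha> \<in> o(\<lambda>n. real n)"
  then have "(\<lambda>n. \<alpha> n / real n) \<longlonglongrightarrow> 0"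
    by (rule smalloD_tendsto)
  then have "(\<lambda>n. OPT_rand n (\<alpha> n)) \<longlonglongrightarrow> 0"
    using tendsto_OPT_rand[OF assms, where c = 0] by simp
  then show "(\<lambda>n. OPT_rand n (\<alpha> n)) \<in> o(\<lambda>_. 1)"
    by (intro smalloI_tendsto) auto
next
  fix c :: real
  assume "c > 0" "(\<lambda>n. \<alpha> n / real n) \<longlonglongrightarrow> c"
  then show "(\<lambda>n. OPT_rand n (\<alpha> n)) \<longlonglongrightarrow> 1 - exp (- c)"
    by (intro tendsto_OPT_rand assms) auto
qed

end
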